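(* Let $N\ge1$ be an integer and $\Delta t=1/N$. Let $\mathbf{Q}_\beta^n,\mathbf{P}_\beta^n\in\mathbb{R}^2$ ($\beta=1,\ldots,n_p$, $n=0,\ldots,N$) and $\mathbf{u}_k^{n+1}\in\mathbb{R}^2$ ($k=1,\ldots,n_g$, $n=0,\ldots,N-1$) satisfy the symplectic Euler equations $$\frac{\partial}{\partial\mathbf{u}_k}\frac12\|\mathbf{u}^{n+1}\|_g^2=\sum_{\beta=1}^{n_p}\mathbf{P}_\beta^{n+1}\psi_k(\mathbf{Q}_\beta^n),$$ $$\mathbf{Q}_\beta^{n+1}=\mathbf{Q}_\beta^n+\Delta t\sum_{k=1}^{n_g}\mathbf{u}_k^{n+1}\psi_k(\mathbf{Q}_\beta^n),$$ $$\mathbf{P}_\beta^{n+1}=\mathbf{P}_\beta^n-\Delta t\,\mathbf{P}_\beta^{n+1}\cdot\sum_{k=1}^{n_g}\mathbf{u}_k^{n+1}\nabla\psi_k(\mathbf{Q}_\beta^n),$$ for $n=0,\ldots,N-1$, all $k$ and all $\beta$, and let the $2\times2$ matrices $J_\beta^n$ be defined by $J_\beta^0=\mathrm{Id}$ and $$J_\beta^{n+1}=J_\beta^n+\Delta t\Big(\sum_{k=1}^{n_g}\mathbf{u}_k^{n+1}\nabla\psi_k(\mathbf{Q}_\beta^n)\Big)J_\beta^n .$$ Then for each $\beta=1,\ldots,n_p$ the quantity $J_\beta^T\mathbf{P}_\beta$ is conserved: $(J_\beta^{n+1})^T\mathbf{P}_\beta^{n+1}=(J_\beta^n)^T\mathbf{P}_\beta^n$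 for all $n=0,\ldots,N-1$.
   Context: Setting: $n_g$ and $n_p$ are positive integers. The functions $\psi_k:\mathbb{R}^2\to\mathbb{R}$, $k=1,\ldots,n_g$, are fixed basis functions (assumed continuously differentiable) attached to mesh points $\mathbf{x}_k$; a mesh velocity $\mathbf{u}=(\mathbf{u}_1,\ldots,\mathbf{u}_{n_g})\in(\mathbb{R}^2)^{n_g}$ represents the vector field $\mathbf{u}(\mathbf{x})=\sum_k\mathbf{u}_k\psi_k(\mathbf{x})$. $\|\cdot\|_g^2$ is a fixed discretised squared norm on $(\mathbb{R}^2)^{n_g}$ (a positive-definite quadratic form). Superscripts $n$ denote time levels. Notation: $\mathbf{u}_k\nabla\psi_k(\mathbf{x})$ is the $2\times2$ matrix with $(i,j)$ entry $(\mathbf{u}_k)_i\,\partial\psi_k/\partial x_j(\mathbf{x})$, so that $\sum_k\mathbf{u}_k\nabla\psi_k$ is the Jacobian matrix of the vector field $\sum_k\mathbf{u}_k\psi_k$. For a vector $\mathbf{P}$ and a matrix $M$, $\mathbf{P}\cdot M$ denotes $M^T\mathbf{P}$; thus $\mathbf{P}_\beta\cdot\sum_k\mathbf{u}_k\nabla\psi_k=\sum_k(\mathbf{P}_\beta\cdot\mathbf{u}_k)\nabla\psi_k$. *)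

theory Defs
  imports "HOL-Analysis.Analysis"
begin

definition gradient :: "(real ^ 'm \<Rightarrow> real) \<Rightarrow> real ^ 'm \<Rightarrow> real ^ 'm" where
  "gradient f x = (\<chi> j. frechet_derivative f (at x) (axis j 1))"

definition continuously_differentiable :: "(real ^ 'm \<Rightarrow> real) \<Rightarrow> bool" where
  "continuously_differentiable f \<longleftrightarrow>
     (\<forall>x. f differentiable (at x)) \<and> continuous_on UNIV (gradient f)"

definition outer_product :: "real ^ 'm \<Rightarrow> real ^ 'k \<Rightarrow> real ^ 'k ^ 'm" where
  "outer_product v w = (\<chi> i j. v $ i * w $ j)"

definition positive_definite_form :: "('a::real_vector \<Rightarrow> real) \<Rightarrow> bool" where
  "positive_definite_form q \<longleftrightarrow>
     (\<exists>B. bilinear B \<and> (\<forall>x y. B x y = B y x) \<and> (\<forall>x. q x = B x x)) \<and>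
     (\<forall>x. x \<noteq> 0 \<longrightarrow> q x > 0)"

text \<open>A mesh velocity \<open>u\<close> has one block \<open>u $ k\<close> in the plane per mesh point \<open>k\<close>.
  The partial gradient of \<open>F\<close> with respect to that block is taken with all other blocks held fixed.\<close>

definition has_block_gradient ::
    "((real ^ 'm) ^ 'g \<Rightarrow> real) \<Rightarrow> 'g \<Rightarrow> (real ^ 'm) ^ 'g \<Rightarrow> real ^ 'm \<Rightarrow> bool" where
  "has_block_gradient F k u D \<longleftrightarrow>
     (GDERIV (\<lambda>v. F (\<chi> j. if j = k then v else u $ j)) (u $ k) :> D)"

definition velocity :: "('g::finite \<Rightarrow> real ^ 2 \<Rightarrow> real) \<Rightarrow> (real ^ 2) ^ 'g \<Rightarrow> real ^ 2 \<Rightarrow> real ^ 2" where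
  "velocity \<psi> u x = (\<Sum>k\<in>UNIV. \<psi> k x *\<^sub>R (u $ k))"

definition velocity_gradient ::
    "('g::finite \<Rightarrow> real ^ 2 \<Rightarrow> real) \<Rightarrow> (real ^ 2) ^ 'g \<Rightarrow> real ^ 2 \<Rightarrow> real ^ 2 ^ 2" where
  "velocity_gradient \<psi> u x = (\<Sum>k\<in>UNIV. outer_product (u $ k) (gradient (\<psi> k) x))"

end

theory Submission
  imports Defs
begin

text \<open>The momentum step is implicit: it reads \<open>p = (I + c A)\<^sup>T p'\<close>, and \<open>I + c A\<close> is exactly the factor
  by which the Jacobian is multiplied, so it moves from one factor to the other by transposition.\<close>

lemma transpose_mult_vec_conserved:
  fixes A :: "real ^ 'n ^ 'n" and J J' :: "real ^ 'm ^ 'n" and p p' :: "real ^ 'n"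
  assumes p: "p' = p - c *\<^sub>R (transpose A *v p')"
    and J: "J' = J + c *\<^sub>R (A ** J)"
  shows "transpose J' *v p' = transpose J *v p"
proof -
  \<comment> \<open>Transposition reverses the product \<open>A ** J\<close>, so
    \<open>transpose A\<close> ends up on the right, where it can act on \<open>p'\<close> first.
    Here \<open>mult.commute\<close> swaps real entries inside the sums, not matrices.\<close>
  have "transpose J' = transpose J + c *\<^sub>R (transpose J ** transpose A)"
    unfolding J by (simp add: transpose_def vec_eq_iff matrix_matrix_mult_def mult.commute)
  then have "transpose J' *v p' = transpose J *v p' + c *\<^sub>R (transpose J *v (transpose A *v p'))"
    by (simp only: matrix_vector_mult_add_rdistrib scaleR_matrix_vector_assoc matrix_vector_mul_assoc)
  also have "\<dots> = transpose J *v (p' + c *\<^sub>R (transpose A *v p'))"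
    by (simp add: matrix_vector_right_distrib matrix_vector_mult_scaleR)
  \<comment> \<open>The implicit step is read backwards: it gives the old \<open>p\<close>
    explicitly in terms of \<open>p'\<close>, so I + c A^T never has to be inverted.\<close>
  also have "p' + c *\<^sub>R (transpose A *v p') = p"
    using p by (simp add: algebra_simps)
  finally show ?thesis .
qed

theorem proposition6:
  fixes \<psi> :: "'g::finite \<Rightarrow> real ^ 2 \<Rightarrow> real"
    and normg2 :: "(real ^ 2) ^ 'g \<Rightarrow> real"
    and N :: nat and dt :: real
    and Q P :: "nat \<Rightarrow> 'p::finite \<Rightarrow> real ^ 2"
    and u :: "nat \<Rightarrow> (real ^ 2) ^ 'g"
    and J :: "nat \<Rightarrow> 'p \<Rightarrow> real ^ 2 ^ 2"
  assumes psi_C1: "\<And>k. continuously_differentiable (\<psi> k)"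
    and normg2: "positive_definite_form normg2"
    and N: "N \<ge> 1"
    and dt: "dt = 1 / real N"
    and momentum: "\<And>n k. n < N \<Longrightarrow>
      has_block_gradient (\<lambda>v. 1 / 2 * normg2 v) k (u (n + 1))
        (\<Sum>\<beta>\<in>UNIV. \<psi> k (Q n \<beta>) *\<^sub>R P (n + 1) \<beta>)"
    and Q_step: "\<And>n \<beta>. n < N \<Longrightarrow>
      Q (n + 1) \<beta> = Q n \<beta> + dt *\<^sub>R velocity \<psi> (u (n + 1)) (Q n \<beta>)"
    and P_step: "\<And>n \<beta>. n < N \<Longrightarrow>
      P (n + 1) \<beta> = P n \<beta> -
        dt *\<^sub>R (transpose (velocity_gradient \<psi> (u (n + 1)) (Q n \<beta>)) *v P (n + 1) \<beta>)"
    and J_init: "\<And>\<beta>. J 0 \<beta> = mat 1"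
    and J_step: "\<And>n \<beta>. n < N \<Longrightarrow>
      J (n + 1) \<beta> = J n \<beta> +
        dt *\<^sub>R (velocity_gradient \<psi> (u (n + 1)) (Q n \<beta>) ** J n \<beta>)"
  shows "\<forall>\<beta>. \<forall>n<N. transpose (J (n + 1) \<beta>) *v P (n + 1) \<beta> = transpose (J n \<beta>) *v P n \<beta>"
  \<comment> \<open>Both updates share one matrix \<open>A\<close>, the velocity gradient of the new
    \<open>u (n + 1)\<close> at the old position \<open>Q n \<beta>\<close>, with
    \<open>c = dt\<close>. This match makes the conservation exact at every step.\<close>
  using transpose_mult_vec_conserved[OF P_step J_step] by blast

end
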